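(* Let $n$ be a positive integer. If $n$ is odd, then $n\tau(n)\equiv\sigma(n)$ modulo $8$. If $n$ is not divisible by $3$, then $n\tau(n)\equiv\sigma(n)$ modulo $3$.
   Context: $\sigma(n)=\sum_{d\mid n}d$ is the divisor sum function. $\tau(n)$ is Ramanujan's $\tau$-function, the coefficient of $q^n$ in the $q$-expansion $\Delta=q\prod_{r\geq1}(1-q^r)^{24}=\sum_{n\geq1}\tau(n)q^n$ of the discriminant modular form of weight $12$. *)

theory Defs
  imports
    "HOL-Analysis.Analysis"
    "HOL-Computational_Algebra.Formal_Power_Series"
    "HOL-Number_Theory.Cong"
begin

definition divisor_sigma :: "nat \<Rightarrow> nat" where
  "divisor_sigma n = (\<Sum>d | d dvd n. d)"

text \<open>
  The \<open>q\<close>-expansion of the discriminant form is a formal power series in \<open>q = fps_X\<close> with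
  integer coefficients; the infinite product is the limit in the \<open>q\<close>-adic topology.
  Since \<^const>\<open>prodinf\<close> counts from \<open>0\<close>, the factor for \<open>r \<ge> 1\<close> has index \<open>r - 1\<close>.
\<close>

definition discriminant_fps :: "int fps" where
  "discriminant_fps = fps_X * (\<Prod>r. (1 - fps_X ^ Suc r) ^ 24)"

definition ramanujan_tau :: "nat \<Rightarrow> int" where
  "ramanujan_tau n = fps_nth discriminant_fps n"

text \<open>
  The product converges, so the unspecified value that \<^const>\<open>prodinf\<close> takes on divergent
  products does not occur in the definition.
\<close>

lemma discriminant_factor_nth:
  "fps_nth ((1 - fps_X ^ Suc r :: int fps) ^ m) k = (if k = 0 then 1 else 0)" if "k \<le> r"
  using that
proof (induction m arbitrary: k)
  case (Suc m)
  have "fps_nth ((1 - fps_X ^ Suc r :: int fps) ^ Suc m) k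
      = fps_nth ((1 - fps_X ^ Suc r) ^ m) k - fps_nth (fps_X ^ Suc r * (1 - fps_X ^ Suc r) ^ m) k"
    by (simp add: left_diff_distrib)
  also have "fps_nth (fps_X ^ Suc r * (1 - fps_X ^ Suc r :: int fps) ^ m) k = 0"
    using Suc.prems by (subst fps_X_power_mult_nth) simp
  finally show ?case
    using Suc by simp
qed simp

lemma has_prod_discriminant:
  "(\<lambda>r. (1 - fps_X ^ Suc r :: int fps) ^ 24) has_prod
     Abs_fps (\<lambda>k. fps_nth (\<Prod>r\<le>k. (1 - fps_X ^ Suc r) ^ 24) k)"
    (is "?f has_prod ?L")
proof -
  have step_nth: "fps_nth (\<Prod>r\<le>Suc n. ?f r) k = fps_nth (\<Prod>r\<le>n. ?f r) k" if "k \<le> n" for n k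
  proof -
    have "fps_nth (\<Prod>r\<le>Suc n. ?f r) k
        = (\<Sum>i=0..k. fps_nth (\<Prod>r\<le>n. ?f r) i * fps_nth (?f (Suc n)) (k - i))"
      by (simp only: prod.atMost_Suc fps_mult_nth)
    also have "\<dots> = (\<Sum>i=0..k. if i = k then fps_nth (\<Prod>r\<le>n. ?f r) i else 0)"
      using that by (intro sum.cong refl, subst discriminant_factor_nth) auto
    finally show ?thesis by simp
  qed
  have stable: "fps_nth (\<Prod>r\<le>n. ?f r) k = fps_nth ?L k" if "k \<le> n" for n k
    using that
  proof (induction n rule: dec_induct)
    case (step n)
    then show ?case using step_nth by simp
  qed simp
  have "(\<lambda>n. \<Prod>r\<le>n. ?f r) \<longlonglongrightarrow> ?L"
  proof (rule tendsto_fpsI)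
    fix k
    show "\<forall>\<^sub>F n in sequentially. fps_nth (\<Prod>r\<le>n. ?f r) k = fps_nth ?L k"
      using eventually_ge_at_top[of k] by eventually_elim (rule stable)
  qed
  moreover have "fps_nth ?L 0 = 1"
    by (simp add: fps_nth_power_0)
  then have "?L \<noteq> 0" by (metis fps_zero_nth zero_neq_one)
  ultimately show ?thesis
    unfolding has_prod_def raw_has_prod_def add_0_right by blast
qed

end

theory Submission
  imports Defs
begin

text \<open>
  Both congruences come from a single one: \<open>\<tau>(n) \<equiv> n\<^sup>4 \<sigma>(n)\<close> modulo \<open>24\<close> for every \<open>n\<close>.
  This follows at once from Niebur's formula (\<open>niebur_formula\<close>)

    \<open>\<Delta> = \<theta>\<^sup>4G - 24 (G \<theta>\<^sup>4G - 16 \<theta>G \<theta>\<^sup>3G + 18 (\<theta>\<^sup>2G)\<^sup>2)\<close>,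

  where \<open>G = \<Sum> \<sigma>(n) q\<^sup>n\<close> and \<open>\<theta> = q d/dq\<close>. If every divisor \<open>d\<close> of \<open>n\<close> satisfies \<open>d\<^sup>2 \<equiv> 1\<close>
  modulo \<open>m\<close>, where \<open>m\<close> divides \<open>24\<close>, then \<open>n\<^sup>5 \<sigma>(n) \<equiv> n \<sigma>(n)\<close>, and \<open>n d = d\<^sup>2 (n/d) \<equiv> n/d\<close>
  gives \<open>n \<sigma>(n) \<equiv> \<sigma>(n)\<close>. The cases \<open>m = 8\<close> and \<open>m = 3\<close> are the theorem.

  Niebur's formula holds because both sides solve \<open>\<theta>F = (1 - 24 G) F\<close> and have the same
  coefficient at \<open>q\<close>, and these conditions determine \<open>F\<close>. For \<open>\<Delta>\<close> the equation is the
  logarithmic derivative of the infinite product (\<open>theta_discriminant\<close>). For the right-hand side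
  it is a formal consequence (\<open>theta_niebur_expression\<close>) of Chazy's differential equation

    \<open>\<theta>\<^sup>3G = \<theta>\<^sup>2G - 24 G \<theta>\<^sup>2G + 36 (\<theta>G)\<^sup>2\<close>.

  The arithmetic is in Chazy's equation (\<open>chazy_equation\<close>). Coefficientwise
  it evaluates a sum over all positive solutions of \<open>a x + b y = n\<close>. The solutions with
  \<open>a > b\<close> carry the involution \<open>(a, x, b, y) \<mapsto> (x + y, b, x, a - b)\<close>. Summing a polynomial that
  changes sign under it, and that is unchanged when \<open>(a, x)\<close> and \<open>(b, y)\<close> are exchanged, leaves
  only the solutions with \<open>a = b\<close>, which can be summed directly.
\<close>

section \<open>The Euler operator\<close>

definition theta :: "int fps \<Rightarrow> int fps" where
  "theta f = fps_X * fps_deriv f"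

lemma theta_nth [simp]: "fps_nth (theta f) n = int n * fps_nth f n"
  by (cases n) (simp_all add: theta_def)

lemma theta_add [simp]: "theta (f + g) = theta f + theta g"
  by (simp add: theta_def algebra_simps)

lemma theta_diff [simp]: "theta (f - g) = theta f - theta g"
  by (simp add: theta_def algebra_simps)

lemma theta_mult: "theta (f * g) = theta f * g + f * theta g"
  by (simp add: theta_def algebra_simps)

lemma theta_numeral [simp]: "theta (numeral k) = 0"
  by (simp add: theta_def)

lemma theta_1 [simp]: "theta 1 = 0"
  by (simp add: theta_def)

lemma numeral_mult_nth: "fps_nth (numeral k * f :: int fps) n = numeral k * fps_nth f n"
  by (simp add: numeral_fps_const)

section \<open>Sums over factorizations\<close>

definition factorizations :: "nat \<Rightarrow> (nat \<times> nat) set" where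
  "factorizations n = {(a, x). 0 < a \<and> 0 < x \<and> a * x = n}"

lemma finite_factorizations [simp]: "finite (factorizations n)"
proof (rule finite_subset)
  show "factorizations n \<subseteq> {..n} \<times> {..n}"
    by (auto simp: factorizations_def)
qed simp

lemma factorizations_0 [simp]: "factorizations 0 = {}"
  by (auto simp: factorizations_def)

lemma sum_factorizations_swap:
  "(\<Sum>(a, x)\<in>factorizations n. f a x) = (\<Sum>(a, x)\<in>factorizations n. f x a)"
  by (rule sum.reindex_bij_witness[of _ prod.swap prod.swap])
     (auto simp: factorizations_def mult.commute)

lemma sum_factorizations_fst:
  assumes "n > 0"
  shows "(\<Sum>(a, x)\<in>factorizations n. f a) = (\<Sum>d | d dvd n. f d)"
proof (rule sum.reindex_bij_witness[of _ "\<lambda>d. (d, n div d)" fst])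
qed (use assms in \<open>auto simp: factorizations_def elim!: dvdE\<close>)

lemma divisor_sigma_eq_sum_factorizations:
  "int (divisor_sigma n) = (\<Sum>(a, x)\<in>factorizations n. int a)"
proof (cases "n = 0")
  case True
  then show ?thesis by (simp add: divisor_sigma_def)
next
  case False
  then show ?thesis
    by (simp add: sum_factorizations_fst[where f = int] divisor_sigma_def)
qed

text \<open>
  The coefficient at \<open>n\<close> is the sum of \<open>a\<^sup>p x\<^sup>q\<close> over \<open>a x = n\<close>. In particular \<open>lambert 1 0\<close> is
  \<open>G = \<Sum> \<sigma>(n) q\<^sup>n\<close>, and \<open>lambert (k + 1) k\<close> is \<open>\<theta>\<^sup>kG\<close>. Keeping both exponents turns a
  monomial in \<open>a, x, b, y\<close>, summed over \<open>a x + b y = n\<close>, into a coefficient of a product of two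
  such series, and the symmetry in \<open>p\<close> and \<open>q\<close> becomes available for each factor separately.
\<close>

definition lambert :: "nat \<Rightarrow> nat \<Rightarrow> int fps" where
  "lambert p q = Abs_fps (\<lambda>n. \<Sum>(a, x)\<in>factorizations n. int a ^ p * int x ^ q)"

lemma lambert_commute: "lambert p q = lambert q p"
  unfolding lambert_def
  by (subst sum_factorizations_swap) (simp add: mult.commute)

lemma theta_lambert [simp]: "theta (lambert p q) = lambert (Suc p) (Suc q)"
proof (rule fps_ext)
  fix n
  show "fps_nth (theta (lambert p q)) n = fps_nth (lambert (Suc p) (Suc q)) n"
    unfolding theta_nth lambert_def fps_nth_Abs_fps sum_distrib_left
    by (rule sum.cong) (auto simp: factorizations_def)
qed

lemma lambert_nth_0 [simp]: "fps_nth (lambert p q) 0 = 0"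
  by (simp add: lambert_def)

section \<open>Chazy's differential equation\<close>

definition quads :: "nat \<Rightarrow> (nat \<times> nat \<times> nat \<times> nat) set" where
  "quads n = {(a, x, b, y). 0 < a \<and> 0 < x \<and> 0 < b \<and> 0 < y \<and> a * x + b * y = n}"

lemma finite_quads [simp]: "finite (quads n)"
proof (rule finite_subset)
  have "u \<le> n" if "0 < v" "u * v + w = n" for u v w :: nat
    using that by (metis One_nat_def Suc_leI le_add1 mult_le_mono2 nat_mult_1_right order_trans)
  then show "quads n \<subseteq> {..n} \<times> {..n} \<times> {..n} \<times> {..n}"
    by (force simp: quads_def mult.commute add.commute)
qed simp

lemma lambert_mult_nth:
  "fps_nth (lambert p q * lambert r s) n =
     (\<Sum>(a, x, b, y)\<in>quads n. int a ^ p * int x ^ q * int b ^ r * int y ^ s)"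
proof -
  let ?S = "SIGMA i:{0..n}. factorizations i \<times> factorizations (n - i)"
  have "fps_nth (lambert p q * lambert r s) n =
      (\<Sum>i=0..n. \<Sum>((a, x), (b, y))\<in>factorizations i \<times> factorizations (n - i).
         int a ^ p * int x ^ q * int b ^ r * int y ^ s)"
    by (simp add: fps_mult_nth lambert_def sum_product sum.cartesian_product case_prod_unfold
        mult.assoc)
  also have "\<dots> = (\<Sum>(i, (a, x), (b, y))\<in>?S. int a ^ p * int x ^ q * int b ^ r * int y ^ s)"
    by (subst sum.Sigma) (auto simp: case_prod_unfold)
  also have "\<dots> = (\<Sum>(a, x, b, y)\<in>quads n. int a ^ p * int x ^ q * int b ^ r * int y ^ s)"
    by (rule sum.reindex_bij_witness[of _
          "\<lambda>(a, x, b, y). (a * x, (a, x), (b, y))" "\<lambda>(i, (a, x), (b, y)). (a, x, b, y)"])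
       (auto simp: quads_def factorizations_def)
  finally show ?thesis .
qed

text \<open>
  The exchange of \<open>(a, x)\<close> with \<open>(b, y)\<close> and the map \<open>(a, x, b, y) \<mapsto> (x + y, b, x, a - b)\<close>
  generate a group of \<open>24\<close> linear substitutions that preserve \<open>a x + b y\<close>. The polynomials fixed
  by the first and negated by the second are the averages of polynomials over this group, with
  the corresponding signs. The one below is a form of degree \<open>6\<close> chosen among them so that,
  after the symmetries of the Lambert series are used, only the products
  \<open>G \<theta>\<^sup>2G\<close> and \<open>(\<theta>G)\<^sup>2\<close> survive.
\<close>

definition chazy_weight :: "int \<Rightarrow> int \<Rightarrow> int \<Rightarrow> int \<Rightarrow> int" where
  "chazy_weight a x b y =
     x * b^3 * y^2 + x^2 * b^3 * y + a * b^2 * y^3 - 3 * (a * x^2 * b^2 * y) - a * x^3 * b^2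
     - a^2 * b * y^3 - 3 * (a^2 * x * b * y^2) + a^2 * x^3 * b + a^3 * x * y^2 + a^3 * x^2 * y"

lemma chazy_weight_commute: "chazy_weight a x b y = chazy_weight b y a x"
  by (simp add: chazy_weight_def algebra_simps)

lemma chazy_weight_antisym:
  "chazy_weight (b + c) x b y = - chazy_weight (x + y) b x c"
  by (simp add: chazy_weight_def algebra_simps power2_eq_square power3_eq_cube)

lemma chazy_weight_diagonal: "chazy_weight a x a y = - (a ^ 3 * (x + y) * (x * y))"
  by (simp add: chazy_weight_def algebra_simps power2_eq_square power3_eq_cube)

text \<open>
  With \<open>c = a - b\<close>, the solutions with \<open>a > b\<close> are the positive solutions of
  \<open>b x + c x + b y = n\<close>. This equation is symmetric under exchanging \<open>b\<close> with \<open>x\<close> and \<open>c\<close> with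
  \<open>y\<close>, while the weight changes sign.
\<close>

lemma sum_chazy_weight_above_diagonal:
  "(\<Sum>(a, x, b, y)\<in>{(a, x, b, y)\<in>quads n. b < a}.
      chazy_weight (int a) (int x) (int b) (int y)) = 0"
    (is "?S = 0")
proof -
  let ?R = "{(c, x, b, y). 0 < c \<and> 0 < x \<and> 0 < b \<and> 0 < y \<and> (b + c) * x + b * y = n}"
  have S: "?S = (\<Sum>(c, x, b, y)\<in>?R. chazy_weight (int b + int c) (int x) (int b) (int y))"
    by (rule sum.reindex_bij_witness[of _
          "\<lambda>(c, x, b, y). (b + c, x, b, y)" "\<lambda>(a, x, b, y). (a - b, x, b, y)"])
       (auto simp: quads_def of_nat_diff)
  also have "\<dots> = (\<Sum>(c, x, b, y)\<in>?R. chazy_weight (int x + int y) (int b) (int x) (int c))"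
    by (rule sum.reindex_bij_witness[of _
          "\<lambda>(c, x, b, y). (y, b, x, c)" "\<lambda>(c, x, b, y). (y, b, x, c)"])
       (auto simp: algebra_simps)
  also have "\<dots> = - ?S"
    unfolding S sum_negf [symmetric]
    by (intro sum.cong refl, clarify) (rule chazy_weight_antisym)
  finally show ?thesis by simp
qed

lemma sum_mult_reflected: "6 * (\<Sum>x=1..<m. int x * (int m - int x)) = int m ^ 3 - int m"
proof -
  \<comment> \<open>The induction on \<open>m\<close> needs a summand that does not depend on \<open>m\<close>.\<close>
  have "6 * (\<Sum>x<m. int x * (c - int x)) =
      int m * (int m - 1) * (3 * c - 2 * int m + 1)" for c
    by (induction m) (simp_all add: algebra_simps)
  from this[of "int m"] have "6 * (\<Sum>x<m. int x * (int m - int x)) = int m ^ 3 - int m"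
    by (simp add: algebra_simps power3_eq_cube)
  moreover have "(\<Sum>x<m. int x * (int m - int x)) = (\<Sum>x=1..<m. int x * (int m - int x))"
    by (rule sum.mono_neutral_right) auto
  ultimately show ?thesis by simp
qed

text \<open>
  For \<open>a = b\<close> the equation reads \<open>a m = n\<close> with \<open>m = x + y\<close>. For a given \<open>m\<close> the sum of \<open>x y\<close> is
  \<open>(m\<^sup>3 - m) / 6\<close>, so each factorization \<open>n = a m\<close> contributes \<open>(a\<^sup>3 m\<^sup>2 - a\<^sup>3 m\<^sup>4) / 6\<close>.
\<close>

lemma sum_chazy_weight_diagonal:
  "6 * (\<Sum>(a, x, b, y)\<in>{(a, x, b, y)\<in>quads n. a = b}.
      chazy_weight (int a) (int x) (int b) (int y)) =
     fps_nth (lambert 3 2 - lambert 4 3) n"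
proof -
  let ?S = "SIGMA (a, m):factorizations n. {1..<m}"
  have "(\<Sum>(a, x, b, y)\<in>{(a, x, b, y)\<in>quads n. a = b}.
      chazy_weight (int a) (int x) (int b) (int y)) =
      (\<Sum>((a, m), x)\<in>?S. - (int a ^ 3 * int m * (int x * (int m - int x))))"
    by (rule sum.reindex_bij_witness[of _
          "\<lambda>((a, m), x). (a, x, a, m - x)" "\<lambda>(a, x, b, y). ((a, x + y), x)"])
       (auto simp: quads_def factorizations_def chazy_weight_diagonal of_nat_diff mult.assoc
         simp flip: distrib_left)
  also have "\<dots> = (\<Sum>(a, m)\<in>factorizations n. \<Sum>x=1..<m.
      - (int a ^ 3 * int m * (int x * (int m - int x))))"
    by (subst sum.Sigma [symmetric]) (auto simp: case_prod_unfold)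
  also have "6 * \<dots> = (\<Sum>(a, m)\<in>factorizations n.
      - (int a ^ 3 * int m) * (6 * (\<Sum>x=1..<m. int x * (int m - int x))))"
    by (simp add: sum_distrib_left sum_negf case_prod_unfold algebra_simps)
  also have "\<dots> = (\<Sum>(a, m)\<in>factorizations n. int a ^ 3 * int m ^ 2 - int a ^ 3 * int m ^ 4)"
    unfolding sum_mult_reflected
    by (intro sum.cong refl) (auto simp: algebra_simps eval_nat_numeral)
  also have "\<dots> = fps_nth (lambert 3 2 - lambert 3 4) n"
    by (simp add: lambert_def sum_subtractf case_prod_unfold)
  finally show ?thesis by (simp add: lambert_commute[of 4 3])
qed

text \<open>
  The coefficients of \<open>4 G \<theta>\<^sup>2G - 6 (\<theta>G)\<^sup>2\<close> are the sums of the weight over all solutions. By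
  symmetry and cancellation these are the sums over \<open>a = b\<close>, which are the coefficients of
  \<open>(\<theta>\<^sup>2G - \<theta>\<^sup>3G) / 6\<close>.
\<close>

lemma chazy_equation:
  "lambert 4 3 = lambert 3 2 - 24 * (lambert 1 0 * lambert 3 2) + 36 * lambert 2 1 ^ 2"
proof (rule fps_ext)
  fix n
  let ?w = "\<lambda>(a, x, b, y). chazy_weight (int a) (int x) (int b) (int y)"
  have below: "sum ?w {(a, x, b, y)\<in>quads n. a < b} = sum ?w {(a, x, b, y)\<in>quads n. b < a}"
    by (rule sum.reindex_bij_witness[of _
          "\<lambda>(a, x, b, y). (b, y, a, x)" "\<lambda>(a, x, b, y). (b, y, a, x)"])
       (auto simp: quads_def chazy_weight_commute algebra_simps)
  have split: "quads n = {(a, x, b, y)\<in>quads n. a = b} \<union>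
      ({(a, x, b, y)\<in>quads n. b < a} \<union> {(a, x, b, y)\<in>quads n. a < b})" (is "_ = ?D \<union> (?A \<union> ?B)")
    by auto
  have fin: "finite ?D" "finite ?A" "finite ?B"
    by (auto intro: finite_subset[OF _ finite_quads[of n]])
  have "sum ?w (quads n) = sum ?w ?D + (sum ?w ?A + sum ?w ?B)"
    by (subst split, subst sum.union_disjoint, use fin in auto)
       (subst sum.union_disjoint, use fin in auto)
  then have diag: "6 * sum ?w (quads n) = fps_nth (lambert 3 2 - lambert 4 3) n"
    using below sum_chazy_weight_above_diagonal[of n] sum_chazy_weight_diagonal[of n]
    by simp
  \<comment> \<open>The ten products are the monomials of the weight, read as \<open>a\<^sup>p x\<^sup>q b\<^sup>r y\<^sup>s\<close>.\<close>
  have "sum ?w (quads n) = fps_nth (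
      lambert 0 1 * lambert 3 2 + lambert 0 2 * lambert 3 1 + lambert 1 0 * lambert 2 3
      - 3 * (lambert 1 2 * lambert 2 1) - lambert 1 3 * lambert 2 0
      - lambert 2 0 * lambert 1 3 - 3 * (lambert 2 1 * lambert 1 2)
      + lambert 2 3 * lambert 1 0 + lambert 3 1 * lambert 0 2 + lambert 3 2 * lambert 0 1) n"
    by (simp only: fps_add_nth fps_sub_nth numeral_mult_nth lambert_mult_nth)
       (simp add: chazy_weight_def sum.distrib sum_subtractf sum_distrib_left case_prod_unfold)
  also have "\<dots> = fps_nth (4 * (lambert 1 0 * lambert 3 2) - 6 * lambert 2 1 ^ 2) n"
    by (simp add: lambert_commute[of 0] lambert_commute[of "Suc 0" 2]
        lambert_commute[of "Suc 0" 3] lambert_commute[of 2 3] power2_eq_square algebra_simps numeral_mult_nth)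
  finally show "fps_nth (lambert 4 3) n =
      fps_nth (lambert 3 2 - 24 * (lambert 1 0 * lambert 3 2) + 36 * lambert 2 1 ^ 2) n"
    using diag by (simp add: numeral_mult_nth)
qed

section \<open>Niebur's quadratic expression in the derivatives of G\<close>

text \<open>
  Here \<open>g\<^sub>k\<close> stands for \<open>\<theta>\<^sup>kG\<close>. With \<open>E\<^sub>0 = 1 - 24 G\<close> and \<open>E\<^sub>k = \<theta>\<^sup>kE\<^sub>0\<close>, Chazy's equation takes
  the homogeneous form \<open>E\<^sub>3 = E\<^sub>0 E\<^sub>2 - (3/2) E\<^sub>1\<^sup>2\<close>, and
  \<open>- 24 D = E\<^sub>0 E\<^sub>4 - 16 E\<^sub>1 E\<^sub>3 + 18 E\<^sub>2\<^sup>2\<close>. Two differentiations of Chazy's equation give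
  \<open>g\<^sub>4\<close> and \<open>g\<^sub>5\<close>, and with these \<open>\<theta>D - E\<^sub>0 D\<close> becomes a multiple of Chazy's equation.
\<close>

lemma theta_niebur_expression:
  fixes g0 g1 g2 g3 g4 g5 :: "int fps"
  assumes th: "theta g0 = g1" "theta g1 = g2" "theta g2 = g3" "theta g3 = g4" "theta g4 = g5"
    and chazy: "g3 = g2 - 24 * (g0 * g2) + 36 * g1 ^ 2"
    and D: "D = g4 - 24 * (g0 * g4 - 16 * (g1 * g3) + 18 * g2 ^ 2)"
  shows "theta D = D - 24 * (g0 * D)"
proof -
  note simps = th theta_mult power2_eq_square
  have g4: "g4 = g3 - 24 * (g0 * g3) + 48 * (g1 * g2)"
    using arg_cong[OF chazy, of theta] by (simp add: simps algebra_simps)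
  have g5: "g5 = g4 - 24 * (g0 * g4) + 24 * (g1 * g3) + 48 * g2 ^ 2"
    using arg_cong[OF g4, of theta] by (simp add: simps algebra_simps)
  have "theta D - (D - 24 * (g0 * D)) =
      480 * g2 * (g2 - 24 * (g0 * g2) + 36 * g1 ^ 2 - g3)"
    unfolding D by (simp add: simps) (simp add: g4 g5 algebra_simps power2_eq_square)
  also have "\<dots> = 0"
    using chazy by simp
  finally show ?thesis by simp
qed

definition niebur_fps :: "int fps" where
  "niebur_fps = lambert 5 4 - 24 * (lambert 1 0 * lambert 5 4 - 16 * (lambert 2 1 * lambert 4 3)
     + 18 * lambert 3 2 ^ 2)"

lemma theta_niebur_fps: "theta niebur_fps = niebur_fps - 24 * (lambert 1 0 * niebur_fps)"
  by (rule theta_niebur_expression[OF _ _ _ _ _ chazy_equation niebur_fps_def])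
     (simp_all add: eval_nat_numeral)

section \<open>The logarithmic derivative of the discriminant\<close>

text \<open>
  This is \<open>r q\<^sup>r / (1 - q\<^sup>r)\<close>, the negative of the logarithmic derivative of \<open>1 - q\<^sup>r\<close>
  with respect to \<open>\<theta>\<close>. The sum over all \<open>r\<close> is \<open>G\<close>.
\<close>

definition log_factor :: "nat \<Rightarrow> int fps" where
  "log_factor r = Abs_fps (\<lambda>k. if 0 < k \<and> r dvd k then int r else 0)"

lemma factor_mult_log_factor:
  assumes "r > 0"
  shows "(1 - fps_X ^ r) * log_factor r = of_nat r * fps_X ^ r"
proof (rule fps_ext)
  fix k
  have "r dvd k - r \<longleftrightarrow> r dvd k" if "r \<le> k"
    using that by (simp add: dvd_minus_self)
  then have "fps_nth (log_factor r) k - (if k < r then 0 else fps_nth (log_factor r) (k - r)) =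
      (if k = r then int r else 0)"
    using assms by (auto simp: log_factor_def dest: dvd_imp_le)
  then show "fps_nth ((1 - fps_X ^ r) * log_factor r) k = fps_nth (of_nat r * fps_X ^ r) k"
    by (simp add: left_diff_distrib fps_X_power_mult_nth fps_mult_of_nat_nth)
qed

lemma theta_factor_power:
  assumes "r > 0"
  shows "theta ((1 - fps_X ^ r) ^ m) = - (of_nat m * ((1 - fps_X ^ r) ^ m * log_factor r))"
proof (induction m)
  case 0
  show ?case by (simp add: theta_def)
next
  case (Suc m)
  have "theta (1 - fps_X ^ r) = - (of_nat r * fps_X ^ r)"
    using assms by (intro fps_ext) (auto simp del: theta_diff)
  also have "\<dots> = - ((1 - fps_X ^ r) * log_factor r)"
    using assms by (simp add: factor_mult_log_factor)
  finally have factor: "theta (1 - fps_X ^ r) = - ((1 - fps_X ^ r) * log_factor r)" .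
  show ?case
    unfolding power_Suc theta_mult Suc factor by (simp add: algebra_simps)
qed

lemma theta_prod_factors:
  "theta (\<Prod>r\<le>N. (1 - fps_X ^ Suc r) ^ 24) =
     - (24 * ((\<Prod>r\<le>N. (1 - fps_X ^ Suc r) ^ 24) * (\<Sum>r\<le>N. log_factor (Suc r))))"
proof (induction N)
  case 0
  show ?case using theta_factor_power[of 1 24] by simp
next
  case (Suc N)
  show ?case
    unfolding prod.atMost_Suc sum.atMost_Suc theta_mult Suc
    by (subst theta_factor_power) (simp_all add: algebra_simps)
qed

lemma sum_log_factor_nth:
  assumes "k \<le> N"
  shows "fps_nth (\<Sum>r\<le>N. log_factor (Suc r)) k = fps_nth (lambert 1 0) k"
proof (cases "k = 0")
  case True
  then show ?thesis by (simp add: log_factor_def fps_sum_nth)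
next
  case False
  have "fps_nth (\<Sum>r\<le>N. log_factor (Suc r)) k = (\<Sum>r\<le>N. if Suc r dvd k then int (Suc r) else 0)"
    using False by (simp add: fps_sum_nth log_factor_def)
  also have "\<dots> = (\<Sum>r | r \<le> N \<and> Suc r dvd k. int (Suc r))"
    by (subst sum.inter_filter [symmetric]) auto
  also have "\<dots> = (\<Sum>d | d dvd k. int d)"
    by (rule sum.reindex_bij_witness[of _ "\<lambda>d. d - 1" Suc])
       (use False assms in \<open>auto dest: dvd_imp_le simp: Suc_diff_Suc dvd_pos_nat\<close>)
  also have "\<dots> = fps_nth (lambert 1 0) k"
    using False by (simp add: lambert_def sum_factorizations_fst[where f = int])
  finally show ?thesis .
qed

lemma discriminant_prodinf:
  "(\<Prod>r. (1 - fps_X ^ Suc r :: int fps) ^ 24) =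
     Abs_fps (\<lambda>k. fps_nth (\<Prod>r\<le>k. (1 - fps_X ^ Suc r) ^ 24) k)"
  using has_prod_unique[OF has_prod_discriminant] by simp

lemma discriminant_partial_prod_nth:
  assumes "k \<le> N"
  shows "fps_nth (\<Prod>r\<le>N. (1 - fps_X ^ Suc r :: int fps) ^ 24) k =
    fps_nth (\<Prod>r. (1 - fps_X ^ Suc r) ^ 24) k"
  using assms
proof (induction N rule: dec_induct)
  case base
  show ?case by (simp only: discriminant_prodinf fps_nth_Abs_fps)
next
  case (step N)
  let ?P = "\<Prod>r\<le>N. (1 - fps_X ^ Suc r :: int fps) ^ 24"
  have "fps_nth (\<Prod>r\<le>Suc N. (1 - fps_X ^ Suc r :: int fps) ^ 24) k =
      (\<Sum>i=0..k. fps_nth ?P i * fps_nth ((1 - fps_X ^ Suc (Suc N)) ^ 24) (k - i))"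
    by (simp only: prod.atMost_Suc fps_mult_nth)
  also have "\<dots> = (\<Sum>i=0..k. if i = k then fps_nth ?P i else 0)"
    using step.hyps by (intro sum.cong refl, subst discriminant_factor_nth) auto
  finally show ?case using step by simp
qed

text \<open>
  The coefficient of \<open>q\<^sup>n\<close> in \<open>\<theta>L = - 24 L G\<close> for the infinite product \<open>L\<close> involves only
  coefficients of \<open>L\<close> and \<open>G\<close> up to \<open>n\<close>, so it can be read off from the partial product over
  \<open>r \<le> n\<close>. The factor \<open>q\<close> of the discriminant contributes the summand \<open>1\<close> of \<open>1 - 24 G\<close>.
\<close>

lemma theta_discriminant:
  "theta discriminant_fps = discriminant_fps - 24 * (lambert 1 0 * discriminant_fps)"
proof -
  let ?P = "\<lambda>N. \<Prod>r\<le>N. (1 - fps_X ^ Suc r :: int fps) ^ 24"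
  define L where "L = (\<Prod>r. (1 - fps_X ^ Suc r :: int fps) ^ 24)"
  note partial = discriminant_partial_prod_nth[folded L_def]
  have "theta L = - (24 * (L * lambert 1 0))"
  proof (rule fps_ext)
    fix n
    have "fps_nth (theta L) n = fps_nth (theta (?P n)) n"
      by (simp only: theta_nth partial[OF order_refl])
    also have "\<dots> = - (24 * fps_nth (?P n * (\<Sum>r\<le>n. log_factor (Suc r))) n)"
      by (simp only: theta_prod_factors fps_neg_nth numeral_mult_nth)
    also have "fps_nth (?P n * (\<Sum>r\<le>n. log_factor (Suc r))) n = fps_nth (L * lambert 1 0) n"
      unfolding fps_mult_nth
      by (intro sum.cong refl arg_cong2[where f = "(*)"] partial sum_log_factor_nth) auto
    finally show "fps_nth (theta L) n = fps_nth (- (24 * (L * lambert 1 0))) n"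
      by (simp add: numeral_mult_nth)
  qed
  moreover have "theta fps_X = fps_X"
    by (simp add: theta_def)
  ultimately show ?thesis
    unfolding discriminant_fps_def L_def [symmetric] theta_mult by (simp add: algebra_simps)
qed

lemma discriminant_nth_1: "fps_nth discriminant_fps 1 = 1"
  unfolding discriminant_fps_def discriminant_prodinf by (simp add: fps_nth_power_0)

section \<open>Niebur's formula for the discriminant\<close>

text \<open>
  Since \<open>G\<close> has no constant term, the equation determines \<open>(n - 1) f\<^sub>n\<close> from the coefficients
  before \<open>f\<^sub>n\<close>, so only \<open>f\<^sub>1\<close> is free; in particular \<open>f\<^sub>0 = 0\<close>.
\<close>

lemma theta_equation_unique:
  assumes f: "theta f = f - 24 * (lambert 1 0 * f)" and g: "theta g = g - 24 * (lambert 1 0 * g)"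
    and 1: "fps_nth f 1 = fps_nth g 1"
  shows "f = g"
proof -
  define h where "h = f - g"
  have h: "theta h = h - 24 * (lambert 1 0 * h)"
    unfolding h_def theta_diff f g by (simp add: algebra_simps)
  have "fps_nth h n = 0" for n
  proof (induction n rule: less_induct)
    case (less n)
    have "fps_nth (lambert 1 0 * h) n = (\<Sum>i=0..n. fps_nth (lambert 1 0) i * fps_nth h (n - i))"
      by (rule fps_mult_nth)
    also have "\<dots> = 0"
    proof (intro sum.neutral ballI)
      fix i assume "i \<in> {0..n}"
      then show "fps_nth (lambert 1 0) i * fps_nth h (n - i) = 0"
        using less[of "n - i"] by (cases "i = 0") auto
    qed
    finally have "int n * fps_nth h n = fps_nth h n"
      using arg_cong[OF h, of "\<lambda>F. fps_nth F n"] by (simp add: numeral_mult_nth)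
    then show ?case using 1 by (cases "n = 1") (auto simp: h_def)
  qed
  then show ?thesis by (simp add: h_def fps_eq_iff)
qed

lemma niebur_formula: "discriminant_fps = niebur_fps"
proof (rule theta_equation_unique[OF theta_discriminant theta_niebur_fps])
  have "factorizations 1 = {(1, 1)}"
    by (auto simp: factorizations_def)
  then have "fps_nth (lambert p q) 1 = 1" for p q
    by (simp add: lambert_def)
  then show "fps_nth discriminant_fps 1 = fps_nth niebur_fps 1"
    unfolding discriminant_nth_1
    by (simp add: niebur_fps_def fps_mult_nth numeral_mult_nth power2_eq_square)
qed

section \<open>Congruences for the tau function\<close>

lemma ramanujan_tau_cong: "[ramanujan_tau n = int n ^ 4 * int (divisor_sigma n)] (mod 24)"
proof -
  have "lambert 5 4 = theta (theta (theta (theta (lambert 1 0))))"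
    by (simp add: eval_nat_numeral)
  then have "fps_nth (lambert 5 4) n = int n ^ 4 * fps_nth (lambert 1 0) n"
    by (simp only: theta_nth) (simp add: eval_nat_numeral)
  also have "fps_nth (lambert 1 0) n = int (divisor_sigma n)"
    by (simp add: lambert_def divisor_sigma_eq_sum_factorizations)
  finally show ?thesis
    unfolding ramanujan_tau_def niebur_formula niebur_fps_def fps_sub_nth numeral_mult_nth
    by (simp add: cong_iff_dvd_diff)
qed

text \<open>
  The product \<open>n d\<close> equals \<open>d\<^sup>2 (n/d)\<close>, which is congruent to \<open>n/d\<close>, and \<open>n/d\<close> runs through the
  divisors of \<open>n\<close> together with \<open>d\<close>.
\<close>

lemma mult_divisor_sigma_cong:
  assumes "\<And>d. d dvd n \<Longrightarrow> [int d ^ 2 = 1] (mod m)"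
  shows "[int n * int (divisor_sigma n) = int (divisor_sigma n)] (mod m)"
proof -
  have "[(\<Sum>(a, x)\<in>factorizations n. int a ^ 2 * int x) =
      (\<Sum>(a, x)\<in>factorizations n. 1 * int x)] (mod m)"
  proof (rule cong_sum, clarify)
    fix a x assume "(a, x) \<in> factorizations n"
    then have "[int a ^ 2 = 1] (mod m)"
      by (intro assms) (auto simp: factorizations_def)
    then show "[int a ^ 2 * int x = 1 * int x] (mod m)"
      by (rule cong_scalar_right)
  qed
  moreover have "int n * int (divisor_sigma n) = (\<Sum>(a, x)\<in>factorizations n. int a ^ 2 * int x)"
    unfolding divisor_sigma_eq_sum_factorizations sum_distrib_left
    by (intro sum.cong) (auto simp: factorizations_def power2_eq_square)
  moreover have "(\<Sum>(a, x)\<in>factorizations n. 1 * int x) = int (divisor_sigma n)"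
    unfolding divisor_sigma_eq_sum_factorizations by (subst sum_factorizations_swap) simp
  ultimately show ?thesis by simp
qed

lemma tau_sigma_cong:
  assumes "m dvd 24" and sq: "\<And>d. d dvd n \<Longrightarrow> [int d ^ 2 = 1] (mod m)"
  shows "[int n * ramanujan_tau n = int (divisor_sigma n)] (mod m)"
proof -
  have "[int n * ramanujan_tau n = int n * (int n ^ 4 * int (divisor_sigma n))] (mod m)"
    by (intro cong_mult cong_refl cong_dvd_modulus[OF ramanujan_tau_cong] assms(1))
  also have "[int n * (int n ^ 4 * int (divisor_sigma n)) =
      (int n ^ 2) ^ 2 * (int n * int (divisor_sigma n))] (mod m)"
    by (simp add: eval_nat_numeral mult_ac)
  also have "[(int n ^ 2) ^ 2 * (int n * int (divisor_sigma n)) =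
      1 ^ 2 * int (divisor_sigma n)] (mod m)"
    by (intro cong_mult cong_pow sq dvd_refl mult_divisor_sigma_cong)
  finally show ?thesis by simp
qed

theorem theoremG:
  fixes n :: nat
  assumes "n > 0"
  shows "(odd n \<longrightarrow> [int n * ramanujan_tau n = int (divisor_sigma n)] (mod 8)) \<and>
         (\<not> 3 dvd n \<longrightarrow> [int n * ramanujan_tau n = int (divisor_sigma n)] (mod 3))"
proof (intro conjI impI)
  assume "odd n"
  have "[int d ^ 2 = 1] (mod 8)" if "d dvd n" for d
  proof -
    have "odd d"
      using \<open>odd n\<close> that by auto
    then have "int d mod 8 \<in> {1, 3, 5, 7}"
      by simp presburger
    then show ?thesis
      unfolding cong_def power2_eq_square mod_mult_eq[of "int d" 8 "int d", symmetric] by auto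
  qed
  then show "[int n * ramanujan_tau n = int (divisor_sigma n)] (mod 8)"
    by (intro tau_sigma_cong) auto
next
  assume "\<not> 3 dvd n"
  have "[int d ^ 2 = 1] (mod 3)" if "d dvd n" for d
  proof -
    have "\<not> 3 dvd d"
      using \<open>\<not> 3 dvd n\<close> that dvd_trans by blast
    then have "int d mod 3 = 1 \<or> int d mod 3 = 2"
      by presburger
    then show ?thesis
      unfolding cong_def power2_eq_square mod_mult_eq[of "int d" 3 "int d", symmetric] by auto
  qed
  then show "[int n * ramanujan_tau n = int (divisor_sigma n)] (mod 3)"
    by (intro tau_sigma_cong) auto
qed

end
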